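(* Let $f=t_1+\cdots+t_s+g_{11}\cdots g_{1m_1}+\cdots+g_{l1}\cdots g_{lm_l}\in\mathbb{R}[x_1,\dots,x_n]$ be a summand-reducible polynomial (written in the displayed summand-reduced form), and let $p_{ji}$ be the number of monomials in $g_{ji}$. Then there is an improved version of the standard method for factoring $f$, namely the refined algorithm, which produces matrix factorizations of $f$ whose size is $$2^{\prod_{i=1}^{m_1}p_{1i}+\cdots+\prod_{i=1}^{m_l}p_{li}-\left(\sum_{i=1}^{m_1}p_{1i}+\cdots+\sum_{i=1}^{m_l}p_{li}-\sum_{j=1}^{l}m_j+l\right)}$$ times smaller than the size one obtains with the standard method applied to the expanded form of $f$; that is, the size obtained by the standard method equals the displayed number times the size of the matrix factorization of $f$ produced by the refined algorithm.
   Context: Let $S=\mathbb{R}[x_1,\dots,x_n]$. A matrix factorization of size $N$ of $f\in S$ is a pair $(\phi,\psi)$ of $N\times N$ matrices over $S$ with $\phi\psi=\psi\phi=fI_N$. Summand-reducible polynomials. A polynomial $f$ is summand-reducible if it can be written in the form $f=t_1+\cdots+t_s+g_{11}\cdots g_{1m_1}+\cdots+g_{l1}\cdots g_{lm_l}$ (called summand-reduced form), where: (1) if $s=0$ there are at least two products $g_{11}\cdots g_{1m_1}$, $g_{21}\cdots g_{2m_2}$ in $f$; if $s\neq0$ there is at least one product $g_{11}\cdots g_{1m_1}$ in $f$; (2) each $t_i$ is a monomial, so $t_i=h_{i1}h_{i2}$ where $h_{i1},h_{i2}$ are products of variables possibly raised to some power; (3) for each $j=1,\dots,l$, $g_{j1}\cdots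 g_{jm_j}$ is a product of sums of monomials which, if expanded, would have more monomials than the number that appears in the factor form $g_{j1}\cdots g_{jm_j}$; (4) at least one of the products $g_{j1}\cdots g_{jm_j}$ has at least two factors. Standard method. For a polynomial $f_k=a_1b_1+\cdots+a_kb_k$ written as a sum of $k$ monomials $a_ib_i$: start with the $1\times1$ factorization $([a_1],[b_1])$ of $a_1b_1$; given a factorization $(C,D)$ of size $N$ of $f_{i-1}=a_1b_1+\cdots+a_{i-1}b_{i-1}$, take $$\left(\begin{bmatrix}C&-a_iI_N\\ b_iI_N&D\end{bmatrix},\begin{bmatrix}D&a_iI_N\\-b_iI_N&C\end{bmatrix}\right)$$ as a factorization of size $2N$ of $f_i$. A sum of $k$ monomials thus gets a factorization of size $2^{k-1}$. The standard method is always applied to the expanded form of a polynomial (sum of monomials). The expanded form of the summand-reduced expression of $f$ is taken to have $s+\sum_{j=1}^l\prod_{i=1}^{m_j}p_{ji}$ monomials (one for each choice of one monomial in each factor of each product, plus $t_1,\dots,t_s$). Tensor products. For matrix factorizations $X=(\phi,\psi)$ of $u\in S$ of size $a$ and $X'=(\phi',\psi')$ of $v\in S$ of size $b$, with $\otimes$ the Kronecker product: the Yoshino tensor product is $$X\,\widehat{\otimes}\,X'=\left(\begin{bmatrix}\phi\otimes 1_b&1_a\otimes\phi'\\-1_a\otimes\psi'&\psi\otimes1_b\end{bmatrix},\begin{bmatrix}\psi\otimes1_b&-1_a\otimes\phi'\\1_a\otimes\psi'&\phi\otimes1_b\end{bmatrix}\right),$$ a matrix factorization of $u+v$ of size $2ab$;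 the refined multiplicative tensor product is $X\,\overline{\otimes}\,X'=(\phi\otimes\phi',\psi\otimes\psi')$. Refined algorithm (for $f$ in summand-reduced form): (i) apply the standard method to each $g_{ji}$ (a sum of $p_{ji}$ monomials); (ii) for each $j$, combine the resulting factorizations of $g_{j1},\dots,g_{jm_j}$ with $\overline{\otimes}$ to get a factorization of $g_{j1}\cdots g_{jm_j}$; (iii) combine these over $j=1,\dots,l$ with $\widehat{\otimes}$ to get a factorization $(C,D)$ of $g_{11}\cdots g_{1m_1}+\cdots+g_{l1}\cdots g_{lm_l}$; (iv) if $s=0$, output $(C,D)$; otherwise apply the standard method to $t_1+\cdots+t_s$ to get $(A,B)$, and output $(A,B)\,\widehat{\otimes}\,(C,D)$. *)

theory Defs
  imports
    "HOL-Library.Poly_Mapping"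
    "HOL-Library.Multiset"
    "Jordan_Normal_Form.Matrix"
begin

text \<open>
  A polynomial over the reals maps exponent vectors to coefficients; the variables are indexed
  by the type \<open>'n\<close>, so that a finite type \<open>'n\<close> with \<open>n\<close> elements gives the ring in \<open>n\<close> variables.
\<close>

type_synonym 'n rpoly = "('n \<Rightarrow>\<^sub>0 nat) \<Rightarrow>\<^sub>0 real"

text \<open>
  Nonzero real coefficients are allowed. Otherwise only polynomials with natural number
  coefficients could be written as sums of monomials.
\<close>

definition is_monomial :: "'n rpoly \<Rightarrow> bool" where
  "is_monomial p \<longleftrightarrow> (\<exists>\<alpha> c. c \<noteq> 0 \<and> p = Poly_Mapping.single \<alpha> c)"

definition monomials_of :: "'n rpoly \<Rightarrow> 'n rpoly multiset" where
  "monomials_of g = image_mset (\<lambda>\<alpha>. Poly_Mapping.single \<alpha> (Poly_Mapping.lookup g \<alpha>)) (mset_set (Poly_Mapping.keys g))"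

definition num_monomials :: "'n rpoly \<Rightarrow> nat" where
  "num_monomials g = size (monomials_of g)"

text \<open>
  The form \<open>t\<^sub>1 + \<dots> + t\<^sub>s + g\<^sub>1\<^sub>1 \<cdots> g\<^sub>1\<^sub>m + \<dots>\<close> is represented by the list \<open>ts\<close> of the \<open>t\<^sub>i\<close> and the list \<open>gs\<close>
  whose \<open>j\<close>-th entry lists the factors of the \<open>j\<close>-th product.
\<close>

text \<open>
  Expansion is formal: there is one monomial for each choice of one monomial in every factor,
  and like terms are not collected.
\<close>

fun expand_product :: "'n rpoly list \<Rightarrow> 'n rpoly multiset" where
  "expand_product [] = {#1#}"
| "expand_product (g # gs) =
     (\<Sum>u\<in>#monomials_of g. image_mset (\<lambda>v. u * v) (expand_product gs))"

definition expanded_form :: "'n rpoly list \<Rightarrow> 'n rpoly list list \<Rightarrow> 'n rpoly multiset" where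
  "expanded_form ts gs = mset ts + (\<Sum>gj\<leftarrow>gs. expand_product gj)"

definition summand_reduced_form ::
    "'n rpoly \<Rightarrow> 'n rpoly list \<Rightarrow> 'n rpoly list list \<Rightarrow> bool" where
  "summand_reduced_form f ts gs \<longleftrightarrow>
     f = sum_list ts + (\<Sum>gj\<leftarrow>gs. prod_list gj) \<and>
     (\<forall>gj\<in>set gs. gj \<noteq> []) \<and>
     (if ts = [] then 2 \<le> length gs else 1 \<le> length gs) \<and>
     (\<forall>t\<in>set ts. \<exists>h1 h2. is_monomial h1 \<and> is_monomial h2 \<and> t = h1 * h2) \<and>
     (\<forall>gj\<in>set gs. size (expand_product gj) > (\<Sum>g\<leftarrow>gj. num_monomials g)) \<and>
     (\<exists>gj\<in>set gs. 2 \<le> length gj)"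

definition is_matrix_factorization ::
    "'a::comm_ring_1 \<Rightarrow> nat \<Rightarrow> 'a mat \<times> 'a mat \<Rightarrow> bool" where
  "is_matrix_factorization f N X \<longleftrightarrow>
     fst X \<in> carrier_mat N N \<and> snd X \<in> carrier_mat N N \<and>
     fst X * snd X = f \<cdot>\<^sub>m 1\<^sub>m N \<and> snd X * fst X = f \<cdot>\<^sub>m 1\<^sub>m N"

definition mf_size :: "'a mat \<times> 'a mat \<Rightarrow> nat" where
  "mf_size X = dim_row (fst X)"

definition kronecker :: "'a::times mat \<Rightarrow> 'a mat \<Rightarrow> 'a mat" where
  "kronecker A B = mat (dim_row A * dim_row B) (dim_col A * dim_col B)
     (\<lambda>(i, j). A $$ (i div dim_row B, j div dim_col B) * B $$ (i mod dim_row B, j mod dim_col B))"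

definition yoshino_tensor ::
    "'a::comm_ring_1 mat \<times> 'a mat \<Rightarrow> 'a mat \<times> 'a mat \<Rightarrow> 'a mat \<times> 'a mat" where
  "yoshino_tensor X X' =
     (let \<phi> = fst X; \<psi> = snd X; \<phi>' = fst X'; \<psi>' = snd X';
          Ia = 1\<^sub>m (mf_size X); Ib = 1\<^sub>m (mf_size X')
      in (four_block_mat (kronecker \<phi> Ib) (kronecker Ia \<phi>')
            (kronecker (- Ia) \<psi>') (kronecker \<psi> Ib),
          four_block_mat (kronecker \<psi> Ib) (kronecker (- Ia) \<phi>')
            (kronecker Ia \<psi>') (kronecker \<phi> Ib)))"

definition mult_tensor ::
    "'a::comm_ring_1 mat \<times> 'a mat \<Rightarrow> 'a mat \<times> 'a mat \<Rightarrow> 'a mat \<times> 'a mat" where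
  "mult_tensor X X' = (kronecker (fst X) (fst X'), kronecker (snd X) (snd X'))"

text \<open>Iterated binary operation, bracketed to the left; used on nonempty lists only.\<close>

definition foldl1 :: "('a \<Rightarrow> 'a \<Rightarrow> 'a) \<Rightarrow> 'a list \<Rightarrow> 'a" where
  "foldl1 op xs = foldl op (hd xs) (tl xs)"

definition standard_start :: "'a \<times> 'a \<Rightarrow> 'a mat \<times> 'a mat" where
  "standard_start = (\<lambda>(a, b). (mat 1 1 (\<lambda>_. a), mat 1 1 (\<lambda>_. b)))"

definition standard_step ::
    "'a::comm_ring_1 mat \<times> 'a mat \<Rightarrow> 'a \<times> 'a \<Rightarrow> 'a mat \<times> 'a mat" where
  "standard_step X = (\<lambda>(a, b).
     let C = fst X; D = snd X; I = 1\<^sub>m (mf_size X)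
     in (four_block_mat C (- a \<cdot>\<^sub>m I) (b \<cdot>\<^sub>m I) D,
         four_block_mat D (a \<cdot>\<^sub>m I) (- b \<cdot>\<^sub>m I) C))"

definition standard_factorization :: "('a::comm_ring_1 \<times> 'a) list \<Rightarrow> 'a mat \<times> 'a mat" where
  "standard_factorization ps = foldl standard_step (standard_start (hd ps)) (tl ps)"

text \<open>
  The output of the standard method on a sum of monomials depends on their order and on the
  splitting of each monomial as \<open>a * b\<close>, so the method is a relation: \<open>X\<close> is an output for the
  nonempty collection \<open>M\<close> of monomials, for some order and splittings.
\<close>

definition standard_method :: "'n rpoly multiset \<Rightarrow> 'n rpoly mat \<times> 'n rpoly mat \<Rightarrow> bool" where
  "standard_method M X \<longleftrightarrow>
     (\<exists>ps. ps \<noteq> [] \<and> mset (map (\<lambda>(a, b). a * b) ps) = M \<and>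
        (\<forall>(a, b)\<in>set ps. is_monomial a \<and> is_monomial b) \<and>
        X = standard_factorization ps)"

text \<open>The entries of \<open>Yss\<close> are the standard factorizations chosen for the individual factors.\<close>

definition refined_algorithm ::
    "'n rpoly list \<Rightarrow> 'n rpoly list list \<Rightarrow> 'n rpoly mat \<times> 'n rpoly mat \<Rightarrow> bool" where
  "refined_algorithm ts gs X \<longleftrightarrow>
     (\<exists>Yss CD.
        list_all2 (list_all2 (\<lambda>g Y. standard_method (monomials_of g) Y)) gs Yss \<and>
        CD = foldl1 yoshino_tensor (map (foldl1 mult_tensor) Yss) \<and>
        (if ts = [] then X = CD
         else \<exists>AB. standard_method (mset ts) AB \<and> X = yoshino_tensor AB CD))"

end

theory Submission
  imports Defs
begin

text \<open>
  Every operation used preserves matrix factorizations: \<open>mult_tensor\<close> by the mixed product rule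
  for Kronecker products, while \<open>yoshino_tensor\<close> and the step of the standard method are instances of one
  block construction \<open>[P R; -S Q]\<close>, \<open>[Q -R; S P]\<close> built from commuting factorizations \<open>(P, Q)\<close>
  and \<open>(R, S)\<close> of equal size. The sizes depend only on the numbers of monomials: the standard
  method gives \<open>2 ^ (s + \<Sum>\<^sub>j \<Prod>\<^sub>i p\<^sub>j\<^sub>i - 1)\<close> and the refined algorithm
  \<open>2 ^ (s + l - 1 + \<Sum>\<^sub>j \<Sum>\<^sub>i (p\<^sub>j\<^sub>i - 1))\<close>, whatever the orders and splittings chosen.
\<close>

subsection \<open>Kronecker products\<close>

lemma kronecker_carrier:
  assumes "A \<in> carrier_mat m n" "B \<in> carrier_mat p q"
  shows "kronecker A B \<in> carrier_mat (m * p) (n * q)"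
  using assms by (auto simp: kronecker_def)

lemma div_mod_less_mult:
  fixes i :: nat
  assumes "i < m * p"
  shows "i div p < m" "i mod p < p"
proof -
  have "p > 0" using assms by (cases p) auto
  then show "i div p < m" "i mod p < p"
    using assms by (auto simp: less_mult_imp_div_less)
qed

text \<open>The map \<open>k \<mapsto> (k div q, k mod q)\<close> is a bijection from the flat
  indices onto the pairs. It is also the index convention of \<open>kronecker\<close>, so this
  identity factors the inner sum in the mixed product rule.\<close>

lemma sum_lessThan_mult:
  fixes f :: "nat \<Rightarrow> 'a::semiring_0"
  shows "(\<Sum>k<n. f k) * (\<Sum>k<q. g k) = (\<Sum>k<n * q. f (k div q) * g (k mod q))"
proof -
  have "(\<Sum>k<n. f k) * (\<Sum>k<q. g k) = (\<Sum>(i, j)\<in>{..<n} \<times> {..<q}. f i * g j)"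
    by (simp add: sum_product sum.cartesian_product)
  also have "\<dots> = (\<Sum>k<n * q. f (k div q) * g (k mod q))"
  proof (rule sum.reindex_bij_witness[of _ "\<lambda>k. (k div q, k mod q)" "\<lambda>(i, j). i * q + j"])
    \<comment> \<open>The one obligation left to prove by hand: \<open>i * q + j\<close> stays below
      \<open>Suc i * q\<close>, the end of its block of length \<open>q\<close>.\<close>
    fix a assume a: "a \<in> {..<n} \<times> {..<q}"
    obtain i j where ij: "a = (i, j)" "i < n" "j < q" using a by auto
    have "i * q + j < Suc i * q" using ij by simp
    also have "\<dots> \<le> n * q" using ij by (intro mult_le_mono1) simp
    finally show "(case a of (i, j) \<Rightarrow> i * q + j) \<in> {..<n * q}" using ij by simp
  qed (auto dest: div_mod_less_mult)
  finally show ?thesis .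
qed

text \<open>The mixed product rule. Commutativity of the entries lets the \<open>B\<close> entry
  move past the \<open>C\<close> entry, after which the sum over flat indices splits into the two
  matrix products.\<close>

lemma kronecker_mult:
  fixes A B C D :: "'a::comm_semiring_0 mat"
  assumes "A \<in> carrier_mat m n" "C \<in> carrier_mat n r"
    and "B \<in> carrier_mat p q" "D \<in> carrier_mat q s"
  shows "kronecker A B * kronecker C D = kronecker (A * C) (B * D)"
proof (rule eq_matI)
  fix i j
  assume "i < dim_row (kronecker (A * C) (B * D))" "j < dim_col (kronecker (A * C) (B * D))"
  then have i: "i < m * p" and j: "j < r * s"
    using assms by (auto simp: kronecker_def)
  note ij = div_mod_less_mult[OF i] div_mod_less_mult[OF j]
  have "(kronecker A B * kronecker C D) $$ (i, j) =
      (\<Sum>k<n * q. (A $$ (i div p, k div q) * B $$ (i mod p, k mod q)) *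
        (C $$ (k div q, j div s) * D $$ (k mod q, j mod s)))"
    using assms i j by (auto simp: kronecker_def scalar_prod_def atLeast0LessThan intro!: sum.cong)
  also have "\<dots> = (\<Sum>k<n * q. (A $$ (i div p, k div q) * C $$ (k div q, j div s)) *
        (B $$ (i mod p, k mod q) * D $$ (k mod q, j mod s)))"
    by (simp add: mult_ac)
  also have "\<dots> = (\<Sum>k<n. A $$ (i div p, k) * C $$ (k, j div s)) *
      (\<Sum>k<q. B $$ (i mod p, k) * D $$ (k, j mod s))"
    by (rule sum_lessThan_mult[symmetric])
  also have "\<dots> = kronecker (A * C) (B * D) $$ (i, j)"
    using assms i j ij by (simp add: kronecker_def scalar_prod_def atLeast0LessThan)
  finally show "(kronecker A B * kronecker C D) $$ (i, j) = kronecker (A * C) (B * D) $$ (i, j)" .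
qed (use assms in \<open>auto simp: kronecker_def\<close>)

lemma kronecker_smult_one:
  fixes c d :: "'a::comm_ring_1"
  shows "kronecker (c \<cdot>\<^sub>m 1\<^sub>m m) (d \<cdot>\<^sub>m 1\<^sub>m n) = (c * d) \<cdot>\<^sub>m 1\<^sub>m (m * n)"
proof (rule eq_matI)
  fix i j
  assume "i < dim_row ((c * d) \<cdot>\<^sub>m 1\<^sub>m (m * n))" "j < dim_col ((c * d) \<cdot>\<^sub>m 1\<^sub>m (m * n))"
  then have ij: "i < m * n" "j < m * n" by auto
  note less = div_mod_less_mult[OF ij(1)] div_mod_less_mult[OF ij(2)]
  \<comment> \<open>The diagonal entry test for flat indices is the product of the tests for
    quotients and for remainders.\<close>
  have "i = j \<longleftrightarrow> i div n = j div n \<and> i mod n = j mod n"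
    by (metis div_mult_mod_eq)
  then show "kronecker (c \<cdot>\<^sub>m 1\<^sub>m m) (d \<cdot>\<^sub>m 1\<^sub>m n) $$ (i, j) = ((c * d) \<cdot>\<^sub>m 1\<^sub>m (m * n)) $$ (i, j)"
    using ij less by (auto simp: kronecker_def)
qed (auto simp: kronecker_def)

text \<open>Moves the sign that \<open>yoshino_tensor\<close> puts on the identity matrix out to the
  whole block, where the block construction expects it.\<close>

lemma kronecker_uminus_left:
  fixes A B :: "'a::ring mat"
  shows "kronecker (- A) B = - kronecker A B"
proof (rule eq_matI)
  fix i j
  assume "i < dim_row (- kronecker A B)" "j < dim_col (- kronecker A B)"
  then have ij: "i < dim_row A * dim_row B" "j < dim_col A * dim_col B"
    by (auto simp: kronecker_def)
  show "kronecker (- A) B $$ (i, j) = (- kronecker A B) $$ (i, j)"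
    using ij div_mod_less_mult[OF ij(1)] div_mod_less_mult[OF ij(2)] by (simp add: kronecker_def)
qed (auto simp: kronecker_def)

subsection \<open>Constructions of matrix factorizations\<close>

lemma mf_size_eq: "is_matrix_factorization f N X \<Longrightarrow> mf_size X = N"
  by (auto simp: is_matrix_factorization_def mf_size_def)

lemma four_block_smult_one:
  fixes f :: "'a::comm_ring_1"
  shows "four_block_mat (f \<cdot>\<^sub>m 1\<^sub>m N) (0\<^sub>m N N) (0\<^sub>m N N) (f \<cdot>\<^sub>m 1\<^sub>m N) = f \<cdot>\<^sub>m 1\<^sub>m (2 * N)"
  using smult_four_block_mat[of "1\<^sub>m N" N N "0\<^sub>m N N" N "0\<^sub>m N N" N "1\<^sub>m N" f]
  by (simp add: mult_2)

text \<open>In both products the diagonal blocks add up to \<open>u + v\<close> times the identity,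
  and the four off-diagonal blocks are commutators of one of \<open>P\<close>, \<open>Q\<close> with
  one of \<open>R\<close>, \<open>S\<close>. Each commutation hypothesis kills exactly one of
  them.\<close>

lemma is_matrix_factorization_block:
  fixes P Q R S :: "'a::comm_ring_1 mat"
  assumes PQ: "is_matrix_factorization u N (P, Q)"
    and RS: "is_matrix_factorization v N (R, S)"
    and comm: "P * R = R * P" "P * S = S * P" "Q * R = R * Q" "Q * S = S * Q"
  shows "is_matrix_factorization (u + v) (2 * N)
    (four_block_mat P R (- S) Q, four_block_mat Q (- R) S P)"
proof -
  have [simp]: "P \<in> carrier_mat N N" "Q \<in> carrier_mat N N" "R \<in> carrier_mat N N" "S \<in> carrier_mat N N"
    and prods: "P * Q = u \<cdot>\<^sub>m 1\<^sub>m N" "Q * P = u \<cdot>\<^sub>m 1\<^sub>m N" "R * S = v \<cdot>\<^sub>m 1\<^sub>m N" "S * R = v \<cdot>\<^sub>m 1\<^sub>m N"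
    using PQ RS by (auto simp: is_matrix_factorization_def)
  have [simp]: "dim_row P = N" "dim_col P = N" "dim_row Q = N" "dim_col Q = N"
    "dim_row R = N" "dim_col R = N" "dim_row S = N" "dim_col S = N"
    by (simp_all add: carrier_matD[of _ N N])
  have carrier: "four_block_mat P R (- S) Q \<in> carrier_mat (2 * N) (2 * N)"
    "four_block_mat Q (- R) S P \<in> carrier_mat (2 * N) (2 * N)"
    by (simp_all add: mult_2)
  have cancel: "- A + A = 0\<^sub>m N N" "A + - A = 0\<^sub>m N N" if "A \<in> carrier_mat N N" for A :: "'a mat"
    using that by (auto intro!: eq_matI)
  have add: "u \<cdot>\<^sub>m 1\<^sub>m N + v \<cdot>\<^sub>m 1\<^sub>m N = (u + v) \<cdot>\<^sub>m 1\<^sub>m N" "v \<cdot>\<^sub>m 1\<^sub>m N + u \<cdot>\<^sub>m 1\<^sub>m N = (u + v) \<cdot>\<^sub>m 1\<^sub>m N"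
    by (auto intro!: eq_matI simp: algebra_simps)
  have [simp]: "A * B \<in> carrier_mat N N" if "A \<in> carrier_mat N N" "B \<in> carrier_mat N N" for A B :: "'a mat"
    using that by (rule mult_carrier_mat)
  have neg: "- A * B = - (A * B)" "A * - B = - (A * B)"
    if "A \<in> carrier_mat N N" "B \<in> carrier_mat N N" for A B :: "'a mat"
    using that by auto
  have "four_block_mat P R (- S) Q * four_block_mat Q (- R) S P =
      four_block_mat (P * Q + R * S) (P * - R + R * P) (- S * Q + Q * S) (- S * - R + Q * P)"
    by (rule mult_four_block_mat[of _ N N _ N _ N _ _ N _ N]) simp_all
  also have "\<dots> = four_block_mat ((u + v) \<cdot>\<^sub>m 1\<^sub>m N) (0\<^sub>m N N) (0\<^sub>m N N) ((u + v) \<cdot>\<^sub>m 1\<^sub>m N)"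
  proof (rule cong_four_block_mat)
    show "P * Q + R * S = (u + v) \<cdot>\<^sub>m 1\<^sub>m N" by (simp only: prods add)
    show "P * - R + R * P = 0\<^sub>m N N" by (simp add: neg comm(1) cancel)
    show "- S * Q + Q * S = 0\<^sub>m N N" by (simp add: neg comm(4) cancel)
    show "- S * - R + Q * P = (u + v) \<cdot>\<^sub>m 1\<^sub>m N" by (simp add: neg prods add)
  qed
  finally have "four_block_mat P R (- S) Q * four_block_mat Q (- R) S P = (u + v) \<cdot>\<^sub>m 1\<^sub>m (2 * N)"
    by (simp only: four_block_smult_one)
  moreover have "four_block_mat Q (- R) S P * four_block_mat P R (- S) Q =
      four_block_mat (Q * P + - R * - S) (Q * R + - R * Q) (S * P + P * - S) (S * R + P * Q)"
    by (rule mult_four_block_mat[of _ N N _ N _ N _ _ N _ N]) simp_all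
  moreover have "\<dots> = four_block_mat ((u + v) \<cdot>\<^sub>m 1\<^sub>m N) (0\<^sub>m N N) (0\<^sub>m N N) ((u + v) \<cdot>\<^sub>m 1\<^sub>m N)"
  proof (rule cong_four_block_mat)
    show "Q * P + - R * - S = (u + v) \<cdot>\<^sub>m 1\<^sub>m N" by (simp add: neg prods add)
    show "Q * R + - R * Q = 0\<^sub>m N N" by (simp add: neg comm(3) cancel)
    show "S * P + P * - S = 0\<^sub>m N N" by (simp add: neg comm(2) cancel)
    show "S * R + P * Q = (u + v) \<cdot>\<^sub>m 1\<^sub>m N" by (simp only: prods add)
  qed
  ultimately show ?thesis
    using carrier
    by (simp only: is_matrix_factorization_def fst_conv snd_conv four_block_smult_one simp_thms)
qed

lemma is_matrix_factorization_mult_tensor: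
  assumes "is_matrix_factorization u m X" "is_matrix_factorization v n Y"
  shows "is_matrix_factorization (u * v) (m * n) (mult_tensor X Y)"
  using assms
  by (auto simp: is_matrix_factorization_def mult_tensor_def kronecker_smult_one
      kronecker_mult[of _ m m _ m _ n n _ n] intro: kronecker_carrier)

text \<open>The two factorizations are inflated to the common size \<open>m * n\<close> by tensoring
  with identities on opposite sides. They then act on different tensor factors, so they commute: by
  the mixed product rule both orders give \<open>kronecker E F\<close>.\<close>

lemma is_matrix_factorization_yoshino_tensor:
  assumes "is_matrix_factorization u m X" "is_matrix_factorization v n Y"
  shows "is_matrix_factorization (u + v) (2 * (m * n)) (yoshino_tensor X Y)"
proof -
  obtain A B C D where XY: "X = (A, B)" "Y = (C, D)" by (cases X, cases Y)
  have [simp]: "A \<in> carrier_mat m m" "B \<in> carrier_mat m m" "C \<in> carrier_mat n n" "D \<in> carrier_mat n n"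
    and prods: "A * B = u \<cdot>\<^sub>m 1\<^sub>m m" "B * A = u \<cdot>\<^sub>m 1\<^sub>m m" "C * D = v \<cdot>\<^sub>m 1\<^sub>m n" "D * C = v \<cdot>\<^sub>m 1\<^sub>m n"
    using assms by (auto simp: XY is_matrix_factorization_def)
  have smult_one: "1 \<cdot>\<^sub>m 1\<^sub>m k = (1\<^sub>m k :: 'a mat)" for k
    by (auto intro!: eq_matI)
  have one: "kronecker (c \<cdot>\<^sub>m 1\<^sub>m m) (1\<^sub>m n) = c \<cdot>\<^sub>m 1\<^sub>m (m * n)"
    "kronecker (1\<^sub>m m) (c \<cdot>\<^sub>m 1\<^sub>m n) = c \<cdot>\<^sub>m 1\<^sub>m (m * n)" for c :: 'a
    using kronecker_smult_one[of c m 1 n] kronecker_smult_one[of 1 m c n]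
    by (simp_all add: smult_one)
  have comm: "kronecker E (1\<^sub>m n) * kronecker (1\<^sub>m m) F = kronecker (1\<^sub>m m) F * kronecker E (1\<^sub>m n)"
    if "E \<in> carrier_mat m m" "F \<in> carrier_mat n n" for E F :: "'a mat"
    using that by (simp add: kronecker_mult[of _ m m _ m _ n n _ n])
  have "is_matrix_factorization u (m * n) (kronecker A (1\<^sub>m n), kronecker B (1\<^sub>m n))"
    by (auto simp: is_matrix_factorization_def kronecker_mult[of _ m m _ m _ n n _ n] prods one
        intro: kronecker_carrier)
  moreover have "is_matrix_factorization v (m * n) (kronecker (1\<^sub>m m) C, kronecker (1\<^sub>m m) D)"
    by (auto simp: is_matrix_factorization_def kronecker_mult[of _ m m _ m _ n n _ n] prods one
        intro: kronecker_carrier)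
  ultimately have "is_matrix_factorization (u + v) (2 * (m * n))
     (four_block_mat (kronecker A (1\<^sub>m n)) (kronecker (1\<^sub>m m) C)
        (- kronecker (1\<^sub>m m) D) (kronecker B (1\<^sub>m n)),
      four_block_mat (kronecker B (1\<^sub>m n)) (- kronecker (1\<^sub>m m) C)
        (kronecker (1\<^sub>m m) D) (kronecker A (1\<^sub>m n)))"
    by (rule is_matrix_factorization_block) (simp_all add: comm)
  then show ?thesis
    using mf_size_eq[OF assms(1)] mf_size_eq[OF assms(2)]
    by (simp add: yoshino_tensor_def XY Let_def kronecker_uminus_left)
qed

section \<open>The standard method\<close>

lemma is_matrix_factorization_standard_step:
  assumes "is_matrix_factorization u N X"
  shows "is_matrix_factorization (u + a * b) (2 * N) (standard_step X (a, b))"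
proof -
  obtain C D where X: "X = (C, D)" by (cases X)
  have [simp]: "C \<in> carrier_mat N N" "D \<in> carrier_mat N N"
    using assms by (auto simp: X is_matrix_factorization_def)
  \<comment> \<open>Both signs are negative: they cancel in the product \<open>a * b\<close>, and
    the block construction then yields the sign pattern of \<open>standard_step\<close>. Scalar
    matrices commute with everything.\<close>
  have ab: "is_matrix_factorization (a * b) N (- a \<cdot>\<^sub>m 1\<^sub>m N, - b \<cdot>\<^sub>m 1\<^sub>m N)"
    by (auto simp: is_matrix_factorization_def mult_smult_distrib[of _ N N _ N]
        mult_smult_assoc_mat[of _ N N _ N] mult.commute intro!: eq_matI)
  have comm: "E * (c \<cdot>\<^sub>m 1\<^sub>m N) = (c \<cdot>\<^sub>m 1\<^sub>m N) * E" if "E \<in> carrier_mat N N" for E :: "'a mat" and c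
    using that by (simp add: mult_smult_distrib[of _ N N _ N] mult_smult_assoc_mat[of _ N N _ N])
  have uminus: "- (- c \<cdot>\<^sub>m 1\<^sub>m N) = c \<cdot>\<^sub>m 1\<^sub>m N" for c :: 'a
    by (auto intro!: eq_matI)
  have "is_matrix_factorization (u + a * b) (2 * N)
    (four_block_mat C (- a \<cdot>\<^sub>m 1\<^sub>m N) (- (- b \<cdot>\<^sub>m 1\<^sub>m N)) D,
     four_block_mat D (- (- a \<cdot>\<^sub>m 1\<^sub>m N)) (- b \<cdot>\<^sub>m 1\<^sub>m N) C)"
    by (rule is_matrix_factorization_block[OF assms[unfolded X] ab]) (simp_all add: comm)
  then show ?thesis
    using mf_size_eq[OF assms] by (simp add: standard_step_def X Let_def uminus)
qed

lemma is_matrix_factorization_standard_start: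
  fixes a b :: "'a::comm_ring_1"
  shows "is_matrix_factorization (a * b) 1 (standard_start (a, b))"
  by (auto simp: is_matrix_factorization_def standard_start_def scalar_prod_def mult.commute
      intro!: eq_matI)

text \<open>Stated for an arbitrary starting factorization, since \<open>foldl\<close> changes its
  accumulator at every step.\<close>

lemma is_matrix_factorization_foldl_standard_step:
  assumes "is_matrix_factorization u N X"
  shows "is_matrix_factorization (u + (\<Sum>(a, b)\<leftarrow>ps. a * b)) (2 ^ length ps * N) (foldl standard_step X ps)"
  using assms
proof (induction ps arbitrary: u N X)
  case Nil
  then show ?case by simp
next
  case (Cons p ps)
  obtain a b where p: "p = (a, b)" by (cases p)
  from Cons.IH[OF is_matrix_factorization_standard_step[OF Cons.prems, of a b]]
  show ?case by (simp add: p add.assoc mult.left_commute mult.assoc)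
qed

text \<open>The first monomial gives size 1 and each later one doubles it. Order and splittings do
  not enter, so all outputs for \<open>M\<close> have the same size.\<close>

lemma is_matrix_factorization_standard_method:
  assumes "standard_method M X"
  shows "is_matrix_factorization (\<Sum>\<^sub># M) (2 ^ (size M - 1)) X"
proof -
  from assms obtain p ps where M: "mset (map (\<lambda>(a, b). a * b) (p # ps)) = M"
    and X: "X = standard_factorization (p # ps)"
    unfolding standard_method_def by (metis list.exhaust)
  obtain a b where p: "p = (a, b)" by (cases p)
  have "size M = Suc (length ps)" "\<Sum>\<^sub># M = a * b + (\<Sum>(a, b)\<leftarrow>ps. a * b)"
    by (simp_all add: M[symmetric] p sum_mset_sum_list flip: mset_map)
  then show ?thesis
    using is_matrix_factorization_foldl_standard_step[OF is_matrix_factorization_standard_start, of a b ps]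
    by (simp add: X standard_factorization_def p)
qed

section \<open>Iterated tensor products\<close>

lemma is_matrix_factorization_foldl_mult_tensor:
  assumes "list_all2 (\<lambda>g. is_matrix_factorization (u g) (d g)) gs Ys"
    and "is_matrix_factorization v N X"
  shows "is_matrix_factorization (v * (\<Prod>g\<leftarrow>gs. u g)) (N * (\<Prod>g\<leftarrow>gs. d g)) (foldl mult_tensor X Ys)"
  using assms
proof (induction arbitrary: v N X rule: list_all2_induct)
  case (Cons g gs Y Ys)
  from Cons.IH[OF is_matrix_factorization_mult_tensor[OF Cons.prems Cons.hyps(1)]]
  show ?case by (simp add: mult.assoc)
qed simp

lemma is_matrix_factorization_foldl1_mult_tensor:
  assumes "list_all2 (\<lambda>g. is_matrix_factorization (u g) (d g)) gs Ys" "gs \<noteq> []"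
  shows "is_matrix_factorization (\<Prod>g\<leftarrow>gs. u g) (\<Prod>g\<leftarrow>gs. d g) (foldl1 mult_tensor Ys)"
  using assms by (cases gs) (auto simp: list_all2_Cons1 foldl1_def
      intro: is_matrix_factorization_foldl_mult_tensor)

lemma is_matrix_factorization_foldl_yoshino_tensor:
  assumes "list_all2 (\<lambda>g. is_matrix_factorization (u g) (d g)) gs Ys"
    and "is_matrix_factorization v N X"
  shows "is_matrix_factorization (v + (\<Sum>g\<leftarrow>gs. u g)) (2 ^ length gs * (N * (\<Prod>g\<leftarrow>gs. d g)))
    (foldl yoshino_tensor X Ys)"
  using assms
proof (induction arbitrary: v N X rule: list_all2_induct)
  case (Cons g gs Y Ys)
  from Cons.IH[OF is_matrix_factorization_yoshino_tensor[OF Cons.prems Cons.hyps(1)]]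
  show ?case by (simp add: mult_ac add.assoc)
qed simp

text \<open>Combining \<open>length gs\<close> factorizations takes one tensoring fewer, and each
  tensoring contributes a factor 2.\<close>

lemma is_matrix_factorization_foldl1_yoshino_tensor:
  assumes "list_all2 (\<lambda>g. is_matrix_factorization (u g) (d g)) gs Ys" "gs \<noteq> []"
  shows "is_matrix_factorization (\<Sum>g\<leftarrow>gs. u g) (2 ^ (length gs - 1) * (\<Prod>g\<leftarrow>gs. d g))
    (foldl1 yoshino_tensor Ys)"
  using assms by (cases gs) (auto simp: list_all2_Cons1 foldl1_def
      intro: is_matrix_factorization_foldl_yoshino_tensor)

subsection \<open>Monomials and formal expansion\<close>

lemma is_monomial_mult:
  assumes "is_monomial p" "is_monomial q"
  shows "is_monomial (p * q)"
  using assms unfolding is_monomial_def by (metis mult_single mult_eq_0_iff)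

lemma is_monomial_one: "is_monomial 1"
  unfolding is_monomial_def by (metis single_one zero_neq_one)

lemma is_monomial_monomials_of: "p \<in># monomials_of g \<Longrightarrow> is_monomial p"
  by (auto simp: monomials_of_def is_monomial_def in_keys_iff)

lemma sum_mset_monomials_of: "\<Sum>\<^sub># (monomials_of g) = g"
proof -
  have "\<Sum>\<^sub># (monomials_of g) = (\<Sum>\<alpha>\<in>Poly_Mapping.keys g. Poly_Mapping.single \<alpha> (Poly_Mapping.lookup g \<alpha>))"
    by (simp add: monomials_of_def sum_unfold_sum_mset)
  also have "\<dots> = g"
    by (rule poly_mapping_eqI)
      (auto simp: lookup_sum lookup_single when_def in_keys_iff sum.delta)
  finally show ?thesis .
qed

lemma is_monomial_expand_product:
  "p \<in># expand_product gs \<Longrightarrow> is_monomial p"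
  by (induction gs arbitrary: p)
    (auto simp: is_monomial_one intro: is_monomial_mult is_monomial_monomials_of)

lemma sum_mset_sum_mset: "\<Sum>\<^sub># (\<Sum>u\<in>#M. F u) = (\<Sum>u\<in>#M. \<Sum>\<^sub># (F u))"
  by (induction M) auto

text \<open>Distributivity: the sum of all choices is the product of the sums of the monomials of
  the factors.\<close>

lemma sum_mset_expand_product: "\<Sum>\<^sub># (expand_product gs) = prod_list gs"
proof (induction gs)
  case (Cons g gs)
  have "\<Sum>\<^sub># (expand_product (g # gs)) = (\<Sum>u\<in>#monomials_of g. u * \<Sum>\<^sub># (expand_product gs))"
    by (simp add: sum_mset_sum_mset sum_mset_distrib_left)
  also have "\<dots> = g * prod_list gs"
    by (simp add: Cons sum_mset_monomials_of flip: sum_mset_distrib_right)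
  finally show ?case by simp
qed simp

text \<open>The count is exactly multiplicative because the multiset neither merges nor cancels like
  terms.\<close>

lemma size_expand_product: "size (expand_product gs) = (\<Prod>g\<leftarrow>gs. num_monomials g)"
proof (induction gs)
  case (Cons g gs)
  have "size (\<Sum>u\<in>#M. image_mset (\<lambda>v. u * v) (expand_product gs)) = size M * size (expand_product gs)" for M
    by (induction M) auto
  then show ?case by (simp add: Cons num_monomials_def)
qed simp

lemma sum_mset_expanded_form: "\<Sum>\<^sub># (expanded_form ts gs) = sum_list ts + (\<Sum>gj\<leftarrow>gs. prod_list gj)"
proof -
  have "\<Sum>\<^sub># (\<Sum>gj\<leftarrow>gs. expand_product gj) = (\<Sum>gj\<leftarrow>gs. prod_list gj)"
    by (induction gs) (auto simp: sum_mset_expand_product)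
  then show ?thesis by (simp add: expanded_form_def sum_mset_sum_list)
qed

lemma size_expanded_form:
  "size (expanded_form ts gs) = length ts + (\<Sum>gj\<leftarrow>gs. \<Prod>g\<leftarrow>gj. num_monomials g)"
proof -
  have "size (\<Sum>gj\<leftarrow>gs. expand_product gj) = (\<Sum>gj\<leftarrow>gs. \<Prod>g\<leftarrow>gj. num_monomials g)"
    by (induction gs) (auto simp: size_expand_product)
  then show ?thesis by (simp add: expanded_form_def)
qed

lemma is_monomial_expanded_form:
  assumes "p \<in># expanded_form ts gs" "\<And>t. t \<in> set ts \<Longrightarrow> is_monomial t"
  shows "is_monomial p"
proof -
  have "p \<in># (\<Sum>gj\<leftarrow>gs. expand_product gj) \<Longrightarrow> is_monomial p"
    by (induction gs) (auto intro: is_monomial_expand_product)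
  then show ?thesis using assms by (auto simp: expanded_form_def)
qed

text \<open>Any order with the trivial splittings \<open>p = p * 1\<close> is admissible, as 1 is a
  monomial.\<close>

lemma standard_method_exists:
  assumes "M \<noteq> {#}" "\<And>p. p \<in># M \<Longrightarrow> is_monomial p"
  shows "\<exists>X. standard_method M X"
proof -
  obtain ms where ms: "mset ms = M" using ex_mset by blast
  show ?thesis
    unfolding standard_method_def
    using assms ms by (intro exI[of _ "standard_factorization (map (\<lambda>p. (p, 1)) ms)"]
        exI[of _ "map (\<lambda>p. (p, 1)) ms"]) (auto simp: o_def is_monomial_one)
qed

subsection \<open>Size of the output of the refined algorithm\<close>

lemma prod_list_power: "(\<Prod>x\<leftarrow>xs. c ^ e x) = (c::'a::comm_monoid_mult) ^ (\<Sum>x\<leftarrow>xs. e x)"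
  by (induction xs) (auto simp: power_add)

lemma list_all2_exists:
  assumes "\<And>x. x \<in> set xs \<Longrightarrow> \<exists>y. P x y"
  shows "\<exists>ys. list_all2 P xs ys"
  using assms by (induction xs) (auto simp: list_all2_Cons1)

text \<open>A factor with \<open>p\<close> monomials contributes \<open>p - 1\<close> to the
  exponent, and joining the products contributes \<open>length gs - 1\<close>. The \<open>ts\<close>
  contribute \<open>length ts\<close> in both cases: nothing if there are none, and otherwise
  \<open>length ts - 1\<close> from the standard method plus 1 from the last tensoring.\<close>

lemma is_matrix_factorization_refined_algorithm:
  assumes "refined_algorithm ts gs X" "gs \<noteq> []" "\<And>gj. gj \<in> set gs \<Longrightarrow> gj \<noteq> []"
  shows "is_matrix_factorization (sum_list ts + (\<Sum>gj\<leftarrow>gs. prod_list gj))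
    (2 ^ (length ts + (length gs - 1) + (\<Sum>gj\<leftarrow>gs. \<Sum>g\<leftarrow>gj. num_monomials g - 1))) X"
proof -
  let ?E = "\<lambda>gj. \<Sum>g\<leftarrow>gj. num_monomials g - 1"
  from assms(1) obtain Yss CD where
    Yss: "list_all2 (list_all2 (\<lambda>g. standard_method (monomials_of g))) gs Yss"
    and CD: "CD = foldl1 yoshino_tensor (map (foldl1 mult_tensor) Yss)"
    and X: "if ts = [] then X = CD
         else \<exists>AB. standard_method (mset ts) AB \<and> X = yoshino_tensor AB CD"
    unfolding refined_algorithm_def by blast
  have factor: "is_matrix_factorization g (2 ^ (num_monomials g - 1)) Y"
    if "standard_method (monomials_of g) Y" for g :: "'a rpoly" and Y
    using is_matrix_factorization_standard_method[OF that]
    by (simp add: sum_mset_monomials_of num_monomials_def)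
  have product: "is_matrix_factorization (prod_list gj) (2 ^ ?E gj) (foldl1 mult_tensor Ys)"
    if "gj \<noteq> []" "list_all2 (\<lambda>g. standard_method (monomials_of g)) gj Ys" for gj :: "'a rpoly list" and Ys
    using is_matrix_factorization_foldl1_mult_tensor[of "\<lambda>g. g", OF list_all2_mono[OF that(2) factor] that(1)]
    by (simp add: prod_list_power)
  have "list_all2 (\<lambda>gj. is_matrix_factorization (prod_list gj) (2 ^ ?E gj)) gs
      (map (foldl1 mult_tensor) Yss)"
    using Yss assms(3) product by (auto simp: list_all2_conv_all_nth)
  from is_matrix_factorization_foldl1_yoshino_tensor[OF this assms(2)]
  have CD_mf: "is_matrix_factorization (\<Sum>gj\<leftarrow>gs. prod_list gj)
      (2 ^ ((length gs - 1) + (\<Sum>gj\<leftarrow>gs. ?E gj))) CD"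
    by (simp add: CD prod_list_power power_add)
  show ?thesis
  proof (cases "ts = []")
    case True
    then show ?thesis using X CD_mf by simp
  next
    case False
    with X obtain AB where AB: "standard_method (mset ts) AB" and X: "X = yoshino_tensor AB CD"
      by auto
    have "2 * (2 ^ (length ts - 1) * 2 ^ ((length gs - 1) + (\<Sum>gj\<leftarrow>gs. ?E gj))) =
        (2::nat) ^ (length ts + (length gs - 1) + (\<Sum>gj\<leftarrow>gs. ?E gj))"
      using False by (cases ts) (simp_all add: power_add)
    then show ?thesis
      using is_matrix_factorization_yoshino_tensor[OF is_matrix_factorization_standard_method[OF AB] CD_mf]
      by (simp add: X sum_mset_sum_list)
  qed
qed

text \<open>Positive counts are assumed because the standard method has no output on an empty
  collection, that is, on the zero polynomial.\<close>

lemma refined_algorithm_exists: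
  assumes "\<And>t. t \<in> set ts \<Longrightarrow> is_monomial t"
    and "\<And>gj g. gj \<in> set gs \<Longrightarrow> g \<in> set gj \<Longrightarrow> num_monomials g > 0"
  shows "\<exists>X. refined_algorithm ts gs X"
proof -
  have factor: "\<exists>Y. standard_method (monomials_of g) Y" if "gj \<in> set gs" "g \<in> set gj" for gj g
    using assms(2)[OF that] is_monomial_monomials_of
    by (intro standard_method_exists) (auto simp: num_monomials_def)
  have product: "\<exists>Ys. list_all2 (\<lambda>g. standard_method (monomials_of g)) gj Ys" if "gj \<in> set gs" for gj
    using that by (intro list_all2_exists factor)
  have "\<exists>Yss. list_all2 (list_all2 (\<lambda>g. standard_method (monomials_of g))) gs Yss"
    by (rule list_all2_exists, rule product)
  then obtain Yss where Yss: "list_all2 (list_all2 (\<lambda>g. standard_method (monomials_of g))) gs Yss"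
    by blast
  show ?thesis
  proof (cases "ts = []")
    case True
    then have "refined_algorithm ts gs (foldl1 yoshino_tensor (map (foldl1 mult_tensor) Yss))"
      using Yss by (auto simp: refined_algorithm_def simp del: split_paired_Ex)
    then show ?thesis by blast
  next
    case False
    then obtain AB where "standard_method (mset ts) AB"
      using assms(1) standard_method_exists[of "mset ts"] by auto
    with False Yss have "refined_algorithm ts gs
        (yoshino_tensor AB (foldl1 yoshino_tensor (map (foldl1 mult_tensor) Yss)))"
      by (auto simp: refined_algorithm_def simp del: split_paired_Ex)
    then show ?thesis by blast
  qed
qed

section \<open>Comparison of the two sizes\<close>

theorem theoremB:
  fixes f :: "'n::finite rpoly"
    and ts :: "'n rpoly list"
    and gs :: "'n rpoly list list"
  assumes "summand_reduced_form f ts gs"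
  shows "(\<exists>X. refined_algorithm ts gs X) \<and>
    (\<exists>Y. standard_method (expanded_form ts gs) Y) \<and>
    (\<forall>X Y. refined_algorithm ts gs X \<longrightarrow> standard_method (expanded_form ts gs) Y \<longrightarrow>
       is_matrix_factorization f (mf_size X) X \<and>
       is_matrix_factorization f (mf_size Y) Y \<and>
       mf_size X < mf_size Y \<and>
       real (mf_size Y) =
         2 powi (int (\<Sum>gj\<leftarrow>gs. \<Prod>g\<leftarrow>gj. num_monomials g)
                 - (int (\<Sum>gj\<leftarrow>gs. \<Sum>g\<leftarrow>gj. num_monomials g)
                    - int (\<Sum>gj\<leftarrow>gs. length gj) + int (length gs)))
         * real (mf_size X))"
proof -
  let ?prods = "\<Sum>gj\<leftarrow>gs. \<Prod>g\<leftarrow>gj. num_monomials g"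
  let ?sums = "\<Sum>gj\<leftarrow>gs. \<Sum>g\<leftarrow>gj. num_monomials g"
  let ?lens = "\<Sum>gj\<leftarrow>gs. length gj"
  let ?E = "\<Sum>gj\<leftarrow>gs. \<Sum>g\<leftarrow>gj. num_monomials g - 1"
  from assms have f: "f = sum_list ts + (\<Sum>gj\<leftarrow>gs. prod_list gj)"
    and gj: "\<And>gj. gj \<in> set gs \<Longrightarrow> gj \<noteq> []"
    and gs: "gs \<noteq> []"
    and ts: "\<And>t. t \<in> set ts \<Longrightarrow> is_monomial t"
    and grow: "\<And>gj. gj \<in> set gs \<Longrightarrow> (\<Sum>g\<leftarrow>gj. num_monomials g) < (\<Prod>g\<leftarrow>gj. num_monomials g)"
    unfolding summand_reduced_form_def size_expand_product
    by (auto split: if_splits intro: is_monomial_mult)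
  \<comment> \<open>A zero factor would make the product of the counts 0, which cannot exceed their
    sum.\<close>
  have pos: "num_monomials g > 0" if "gj \<in> set gs" "g \<in> set gj" for gj g
  proof (rule ccontr)
    assume "\<not> num_monomials g > 0"
    then have "(\<Prod>g\<leftarrow>gj. num_monomials g) = 0"
      using that(2) by (force simp: prod_list_zero_iff)
    then show False using grow[OF that(1)] by simp
  qed
  \<comment> \<open>Strict growth gains at least 1 in each product, hence \<open>length gs\<close>
    in total.\<close>
  have grow_sum: "?sums + length gs \<le> ?prods"
  proof -
    have "(\<Sum>gj\<leftarrow>gs. (\<Sum>g\<leftarrow>gj. num_monomials g) + 1) \<le> ?prods"
      using grow by (intro sum_list_mono) (simp add: Suc_le_eq)
    then show ?thesis by (simp only: sum_list_addf) (simp add: sum_list_triv)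
  qed
  \<comment> \<open>The subtraction in \<open>?E\<close> is truncated; giving back 1 per factor
    restores the sum only because every count is positive.\<close>
  have E: "?E + ?lens = ?sums"
  proof -
    have "(\<Sum>g\<leftarrow>gj. num_monomials g - 1) + length gj = (\<Sum>g\<leftarrow>gj. num_monomials g)"
      if "\<And>g. g \<in> set gj \<Longrightarrow> num_monomials g > 0" for gj :: "'n rpoly list"
      using that by (induction gj) fastforce+
    then have "map (\<lambda>gj. (\<Sum>g\<leftarrow>gj. num_monomials g - 1) + length gj) gs =
        map (\<lambda>gj. \<Sum>g\<leftarrow>gj. num_monomials g) gs"
      using pos by simp
    then show ?thesis by (metis (no_types) sum_list_addf)
  qed
  \<comment> \<open>Makes the comparison strict: by \<open>grow_sum\<close> and \<open>E\<close> the
    difference of the exponents is at least \<open>?lens\<close>.\<close>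
  have lens: "?lens > 0"
    using gs gj by (cases gs) auto
  have gs_len: "length gs > 0" using gs by simp
  \<comment> \<open>It has at least \<open>?prods\<close> monomials, hence at least
    \<open>length gs\<close>, even when \<open>ts\<close> is empty.\<close>
  have "expanded_form ts gs \<noteq> {#}"
    using grow_sum gs_len size_expanded_form[of ts gs] by (metis add_is_0 le_zero_eq less_irrefl size_empty)
  then have "\<exists>Y. standard_method (expanded_form ts gs) Y"
    using is_monomial_expanded_form ts by (intro standard_method_exists) blast+
  moreover have "\<exists>X. refined_algorithm ts gs X"
    using ts pos by (rule refined_algorithm_exists)
  moreover have "is_matrix_factorization f (mf_size X) X \<and>
       is_matrix_factorization f (mf_size Y) Y \<and>
       mf_size X < mf_size Y \<and>
       real (mf_size Y) =
         2 powi (int ?prods - (int ?sums - int ?lens + int (length gs))) * real (mf_size X)"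
    if X: "refined_algorithm ts gs X" and Y: "standard_method (expanded_form ts gs) Y" for X Y
  proof -
    \<comment> \<open>The binary logarithms of the two sizes; \<open>length ts\<close> cancels in
      their difference.\<close>
    define a where "a = length ts + (length gs - 1) + ?E"
    define b where "b = length ts + ?prods - 1"
    have mfX: "is_matrix_factorization f (2 ^ a) X"
      using is_matrix_factorization_refined_algorithm[OF X gs gj] by (simp add: f a_def)
    have mfY: "is_matrix_factorization f (2 ^ b) Y"
      using is_matrix_factorization_standard_method[OF Y]
      by (simp add: f b_def sum_mset_expanded_form size_expanded_form)
    have "a < b" using grow_sum E lens gs_len unfolding a_def b_def by linarith
    \<comment> \<open>The integer exponent of the claim is a natural number, so \<open>powi\<close>
      reduces to an ordinary power.\<close>
    moreover have "int ?prods - (int ?sums - int ?lens + int (length gs)) = int (b - a)"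
      using grow_sum E lens gs_len unfolding a_def b_def by linarith
    moreover have "(2::real) ^ b = 2 ^ (b - a) * 2 ^ a"
      using \<open>a < b\<close> by (simp flip: power_add)
    ultimately show ?thesis
      using mfX mfY \<open>a < b\<close>
      by (simp only: mf_size_eq[OF mfX] mf_size_eq[OF mfY] power_int_of_nat) simp
  qed
  ultimately show ?thesis by blast
qed

end
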